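(* Let $\Lambda$ be a lattice in $\mathbb{R}^2$, let $s(\Lambda)$ be the length of the shortest non-zero vector of $\Lambda$, and let $0<\epsilon<s(\Lambda)/2$. Then there is an infinite closed set $\Theta\subseteq S^1$ which is not $(\Lambda,\epsilon)$-good.
   Context: A lattice in $\mathbb{R}^2$ is a discrete subgroup of $\mathbb{R}^2$ of rank 2. $B_\epsilon(0)=\{x\in\mathbb{R}^2:|x|<\epsilon\}$. $S^1$ is the unit circle, identified with the set of angles (mod $2\pi$). $R_\theta$ denotes rotation of $\mathbb{R}^2$ about the origin by the angle $\theta$, and $R_\Theta E = \{R_\theta x: \theta\in\Theta, x\in E\}$. A set $\Theta\subseteq S^1$ is called $(\Lambda,\epsilon)$-good if $R_\Theta E$ contains the complement of a disk, where $E=\Lambda+B_\epsilon(0)$. *)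

theory Defs
  imports "HOL-Analysis.Analysis"
begin

global_interpretation int_module: module "\<lambda>(n::int) (x::real^2). of_int n *\<^sub>R x"
  by unfold_locales (simp_all add: algebra_simps)

(* Rank of an abelian group: the largest number of elements that are linearly
   independent over the integers. *)
definition has_rank :: "(real^2) set \<Rightarrow> nat \<Rightarrow> bool" where
  "has_rank L n \<longleftrightarrow>
     (\<exists>B\<subseteq>L. finite B \<and> int_module.independent B \<and> card B = n) \<and>
     (\<forall>B\<subseteq>L. finite B \<and> int_module.independent B \<longrightarrow> card B \<le> n)"

definition plane_lattice :: "(real^2) set \<Rightarrow> bool" where
  "plane_lattice L \<longleftrightarrow>
     0 \<in> L \<and> (\<forall>x\<in>L. \<forall>y\<in>L. x - y \<in> L) \<and> discrete L \<and> has_rank L 2"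

(* The infimum is attained for every lattice, see shortest_length_attained. *)
definition shortest_length :: "(real^2) set \<Rightarrow> real" where
  "shortest_length L = Inf (norm ` (L - {0}))"

definition thickening :: "(real^2) set \<Rightarrow> real \<Rightarrow> (real^2) set" where
  "thickening L \<epsilon> = {l + b | l b. l \<in> L \<and> b \<in> ball 0 \<epsilon>}"

definition rotation :: "real \<Rightarrow> real^2 \<Rightarrow> real^2" where
  "rotation \<theta> x = vector [cos \<theta> * x$1 - sin \<theta> * x$2, sin \<theta> * x$1 + cos \<theta> * x$2]"

(* A set of angles mod 2 pi is given as a subset of the unit circle in the plane,
   the angle \<theta> being identified with the point (cos \<theta>, sin \<theta>). *)
definition rotate_set :: "(real^2) set \<Rightarrow> (real^2) set \<Rightarrow> (real^2) set" where
  "rotate_set \<Theta> E = {rotation \<theta> x | \<theta> x. vector [cos \<theta>, sin \<theta>] \<in> \<Theta> \<and> x \<in> E}"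

definition good :: "(real^2) set \<Rightarrow> real \<Rightarrow> (real^2) set \<Rightarrow> bool" where
  "good L \<epsilon> \<Theta> \<longleftrightarrow> (\<exists>c r. r > 0 \<and> - ball c r \<subseteq> rotate_set \<Theta> (thickening L \<epsilon>))"

lemma plane_lattice_uniform_discrete:
  assumes "plane_lattice L"
  shows "uniform_discrete L"
proof -
  have "0 isolated_in L"
    using assms by (auto simp: plane_lattice_def discrete_def)
  then obtain e where e: "e > 0" "\<And>y. y \<in> L \<Longrightarrow> dist 0 y < e \<Longrightarrow> y = 0"
    unfolding isolated_in_dist_Ex_iff by blast
  have "x = y" if "x \<in> L" "y \<in> L" "dist x y < e" for x y
  proof -
    have "x - y \<in> L" using assms that by (auto simp: plane_lattice_def)
    moreover have "dist 0 (x - y) < e" using that by (simp add: dist_norm norm_minus_commute)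
    ultimately have "x - y = 0" using e(2) by blast
    then show ?thesis by simp
  qed
  then show ?thesis unfolding uniform_discrete_def using e(1) by blast
qed

lemma shortest_length_attained:
  assumes "plane_lattice L"
  shows "\<exists>v\<in>L - {0}. norm v = shortest_length L \<and> (\<forall>w\<in>L - {0}. norm v \<le> norm w)"
proof -
  obtain B where B: "B \<subseteq> L" "int_module.independent B" "card B = 2"
    using assms by (auto simp: plane_lattice_def has_rank_def)
  have "B \<noteq> {}" using B(3) by auto
  moreover have "0 \<notin> B" using B(2) int_module.dependent_zero by blast
  ultimately obtain u where u: "u \<in> L" "u \<noteq> 0" using B(1) by blast
  let ?S = "(L - {0}) \<inter> cball 0 (norm u)"
  have "uniform_discrete ?S"
    using plane_lattice_uniform_discrete[OF assms] by (rule uniform_discrete_subset) auto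
  moreover have "bounded ?S" by (simp add: bounded_Int)
  ultimately have "finite ?S" using uniform_discrete_finite_iff by blast
  moreover have "u \<in> ?S" using u by simp
  ultimately have "\<exists>v\<in>?S. \<forall>w\<in>?S. norm v \<le> norm w"
    using ex_min_if_finite[of "norm ` ?S"] by (force simp: not_less)
  then obtain v where v: "v \<in> ?S" "\<And>w. w \<in> ?S \<Longrightarrow> norm v \<le> norm w"
    by blast
  have min: "norm v \<le> norm w" if "w \<in> L - {0}" for w
  proof (cases "norm w \<le> norm u")
    case True
    then show ?thesis using that by (intro v(2)) simp
  next
    case False
    then show ?thesis using v(1) by simp
  qed
  have "shortest_length L = norm v"
    unfolding shortest_length_def by (rule cInf_eq_minimum) (use v(1) min in auto)
  then show ?thesis using v(1) min by auto
qed

end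

theory Submission
  imports Defs
begin

text \<open>
  Balls of radius \<open>s(\<Lambda>)/2\<close> about the lattice points are disjoint, so a connected set covered by
  them has diameter below \<open>s(\<Lambda>)\<close>. Hence, for \<open>x\<close> far from the origin, every interval of angles
  contains a subinterval whose rotations move \<open>x\<close> to points at distance at least \<open>\<epsilon>\<close> from \<open>\<Lambda>\<close>,
  and the length of this subinterval is controlled from below. Take points \<open>x\<^sub>n\<close> on an axis, at
  distances growing like a large geometric progression: the angles that work for all \<open>x\<^sub>n\<close>
  simultaneously form a closed set, which is infinite by a Cantor-type construction.
\<close>

section \<open>Nested intervals and a Cantor-type construction\<close>

lemma nested_intervals_meet:
  fixes D :: "nat \<Rightarrow> real set" and len :: "nat \<Rightarrow> real"
  assumes pos: "\<And>n. 0 < len n"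
    and sub: "\<And>n a. 0 \<le> a \<Longrightarrow> a + len n \<le> 1 \<Longrightarrow>
      \<exists>b\<ge>a. b + len (Suc n) \<le> a + len n \<and> {b..b + len (Suc n)} \<subseteq> D n"
    and a: "0 \<le> a" "a + len m \<le> 1"
  shows "\<exists>\<theta>\<in>{a..a + len m}. \<forall>n\<ge>m. \<theta> \<in> D n"
proof -
  let ?P = "\<lambda>n x. 0 \<le> x \<and> x + len (m + n) \<le> 1"
  let ?Q = "\<lambda>n x y. x \<le> y \<and> y + len (Suc (m + n)) \<le> x + len (m + n)
    \<and> {y..y + len (Suc (m + n))} \<subseteq> D (m + n)"
  \<comment> \<open>\<open>c n\<close> is the left end of the interval at stage
    \<open>m + n\<close>; the clause for \<open>n = 0\<close> pins the start to
    \<open>a\<close>.\<close>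
  have "\<exists>c. \<forall>n. (?P n (c n) \<and> (n = 0 \<longrightarrow> c n = a)) \<and> ?Q n (c n) (c (Suc n))"
  proof (rule dependent_nat_choice)
    show "\<exists>x. ?P 0 x \<and> (0 = (0::nat) \<longrightarrow> x = a)" using a by simp
  next
    fix x n assume x: "?P n x \<and> (n = 0 \<longrightarrow> x = a)"
    then obtain y where "x \<le> y" "y + len (Suc (m + n)) \<le> x + len (m + n)"
      "{y..y + len (Suc (m + n))} \<subseteq> D (m + n)" using sub[of x "m + n"] by auto
    with x show "\<exists>y. (?P (Suc n) y \<and> (Suc n = 0 \<longrightarrow> y = a)) \<and> ?Q n x y"
      by (intro exI[of _ y]) auto
  qed
  then obtain c where c0: "c 0 = a" and Q: "\<And>n. ?Q n (c n) (c (Suc n))" by blast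
  define I where "I n = {c n..c n + len (m + n)}" for n
  have "decseq I" unfolding decseq_Suc_iff I_def using Q by auto
  moreover have "I n \<noteq> {}" for n using pos[of "m + n"] by (auto simp: I_def)
  ultimately have "\<Inter>(range I) \<noteq> {}"
    by (intro compact_nest) (auto simp: I_def[abs_def] decseq_def)
  then obtain \<theta> where \<theta>: "\<And>n. \<theta> \<in> I n" by blast
  \<comment> \<open>Membership in \<open>D n\<close> comes one stage later: it is
    \<open>I (Suc (n - m))\<close> that lies inside \<open>D n\<close>.\<close>
  have "\<theta> \<in> D n" if "n \<ge> m" for n
    using \<theta>[of "Suc (n - m)"] Q[of "n - m"] that by (auto simp: I_def)
  moreover have "\<theta> \<in> {a..a + len m}" using \<theta>[of 0] c0 by (simp add: I_def)
  ultimately show ?thesis by blast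
qed

text \<open>Since a third of an interval already contains an interval of the next stage, the two
  outer thirds yield two disjoint ones, and the construction branches at every stage.\<close>

lemma branching_intervals_infinite:
  fixes D :: "nat \<Rightarrow> real set" and len :: "nat \<Rightarrow> real"
  assumes pos: "\<And>n. 0 < len n"
    and third: "\<And>n a. 0 \<le> a \<Longrightarrow> a + len n / 3 \<le> 1 \<Longrightarrow>
      \<exists>b\<ge>a. b + len (Suc n) \<le> a + len n / 3 \<and> {b..b + len (Suc n)} \<subseteq> D n"
    and a: "0 \<le> a" "a + len m \<le> 1"
  shows "infinite {\<theta>\<in>{a..a + len m}. \<forall>n\<ge>m. \<theta> \<in> D n}"
proof -
  let ?S = "\<lambda>a m. {\<theta>\<in>{a..a + len m}. \<forall>n\<ge>m. \<theta> \<in> D n}"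
  have nonempty: "?S a m \<noteq> {}" if "0 \<le> a" "a + len m \<le> 1" for a m
  proof -
    have "\<exists>b\<ge>a. b + len (Suc n) \<le> a + len n \<and> {b..b + len (Suc n)} \<subseteq> D n"
      if "0 \<le> a" "a + len n \<le> 1" for a n
      using third[of a n] that pos[of n] by fastforce
    from nested_intervals_meet[OF pos this \<open>0 \<le> a\<close> \<open>a + len m \<le> 1\<close>] show ?thesis by blast
  qed
  have step: "?S b (Suc m) \<subseteq> ?S a m"
    if "a \<le> b" "b + len (Suc m) \<le> a + len m" "{b..b + len (Suc m)} \<subseteq> D m" for a b m
  proof
    fix \<theta> assume \<theta>: "\<theta> \<in> ?S b (Suc m)"
    have "\<theta> \<in> D n" if "n \<ge> m" for n
      using \<theta> that \<open>{b..b + len (Suc m)} \<subseteq> D m\<close> by (cases "n = m") auto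
    then show "\<theta> \<in> ?S a m" using \<theta> that by auto
  qed
  \<comment> \<open>Subsets of every finite size exclude finiteness. In the induction, one branch
    supplies \<open>k\<close> points and the other a single new point.\<close>
  have "\<exists>T\<subseteq>?S a m. finite T \<and> card T = k" if "0 \<le> a" "a + len m \<le> 1" for a m k
    using that
  proof (induction k arbitrary: a m)
    case 0
    show ?case by (intro exI[of _ "{}"]) auto
  next
    case (Suc k)
    obtain b where b: "a \<le> b" "b + len (Suc m) \<le> a + len m / 3"
      "{b..b + len (Suc m)} \<subseteq> D m" using third[of a m] Suc.prems pos[of m] by auto
    \<comment> \<open>Start of the last third; the middle third separates the two branches, whence
      \<open>b + len (Suc m) < d\<close>.\<close>
    define a' where "a' = a + 2 * (len m / 3)"
    obtain d where d: "a' \<le> d" "d + len (Suc m) \<le> a' + len m / 3"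
      "{d..d + len (Suc m)} \<subseteq> D m"
      using third[of a' m] Suc.prems pos[of m] by (auto simp: a'_def)
    have b': "0 \<le> b" "b + len (Suc m) \<le> 1" "b + len (Suc m) \<le> a + len m"
      using b Suc.prems pos[of m] by linarith+
    have d': "0 \<le> d" "d + len (Suc m) \<le> 1" "d + len (Suc m) \<le> a + len m" "a \<le> d"
      "b + len (Suc m) < d" using b d Suc.prems pos[of m] unfolding a'_def by linarith+
    obtain T where T: "T \<subseteq> ?S d (Suc m)" "finite T" "card T = k"
      using Suc.IH[OF d'(1,2)] by blast
    obtain \<theta> where \<theta>: "\<theta> \<in> ?S b (Suc m)" using nonempty[OF b'(1,2)] by blast
    have "\<theta> \<notin> T" using T(1) \<theta> d'(5) by force
    then have "card (insert \<theta> T) = Suc k" using T by simp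
    moreover have "insert \<theta> T \<subseteq> ?S a m"
      using T(1) \<theta> step[OF b(1) b'(3) b(3)] step[OF d'(4,3) d(3)] by blast
    ultimately show ?case using T(2) by (intro exI[of _ "insert \<theta> T"]) simp
  qed
  then show ?thesis
    by (metis (no_types, lifting) a card_mono not_less_eq_eq order_refl)
qed

section \<open>Disjoint balls about lattice points\<close>

lemma lattice_dist_ge:
  assumes "plane_lattice \<Lambda>" "k \<in> \<Lambda>" "l \<in> \<Lambda>" "k \<noteq> l"
  shows "shortest_length \<Lambda> \<le> dist k l"
proof -
  have "k - l \<in> \<Lambda> - {0}" using assms by (auto simp: plane_lattice_def)
  then show ?thesis using shortest_length_attained[OF assms(1)] by (auto simp: dist_norm)
qed

lemma connected_lattice_balls:
  assumes \<Lambda>: "plane_lattice \<Lambda>" and S: "connected S"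
    and sub: "S \<subseteq> (\<Union>l\<in>\<Lambda>. ball l (shortest_length \<Lambda> / 2))" and "x \<in> S" "y \<in> S"
  shows "dist x y < shortest_length \<Lambda>"
proof -
  let ?B = "\<lambda>l. ball l (shortest_length \<Lambda> / 2)"
  obtain l where l: "l \<in> \<Lambda>" "x \<in> ?B l" using sub \<open>x \<in> S\<close> by blast
  have disj: "?B l \<inter> ?B k = {}" if "k \<in> \<Lambda> - {l}" for k
    using lattice_dist_ge[OF \<Lambda> l(1), of k] that by (intro disjoint_ballI) auto
  \<comment> \<open>Otherwise \<open>?B l\<close> and the union of all the other balls would be open
    sets disconnecting \<open>S\<close>.\<close>
  have "S \<subseteq> ?B l"
  proof (rule ccontr)
    assume "\<not> S \<subseteq> ?B l"
    then have "(\<Union>k\<in>\<Lambda> - {l}. ?B k) \<inter> S \<noteq> {}" using sub by blast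
    moreover have "?B l \<inter> S \<noteq> {}" using l \<open>x \<in> S\<close> by blast
    moreover have "S \<subseteq> ?B l \<union> (\<Union>k\<in>\<Lambda> - {l}. ?B k)" using sub by blast
    moreover have "?B l \<inter> (\<Union>k\<in>\<Lambda> - {l}. ?B k) \<inter> S = {}" using disj by blast
    ultimately show False
      using connectedD[OF S, of "?B l" "\<Union>k\<in>\<Lambda> - {l}. ?B k"] by blast
  qed
  then have "dist l x < shortest_length \<Lambda> / 2" "dist l y < shortest_length \<Lambda> / 2"
    using \<open>x \<in> S\<close> \<open>y \<in> S\<close> by auto
  then show ?thesis using dist_triangle3[of x y l] by linarith
qed

section \<open>Chords and arcs of circles about the origin\<close>

text \<open>Mean value theorem: the derivative \<open>cos\<close> is at least 1/2 on [0, 1], because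
  1 < pi / 3.\<close>

lemma sin_diff_ge_half:
  fixes \<theta> \<phi> :: real
  assumes "0 \<le> \<theta>" "\<theta> \<le> \<phi>" "\<phi> \<le> 1"
  shows "(\<phi> - \<theta>) / 2 \<le> sin \<phi> - sin \<theta>"
proof (cases "\<theta> = \<phi>")
  case False
  then obtain z where z: "\<theta> < z" "z < \<phi>" "sin \<phi> - sin \<theta> = (\<phi> - \<theta>) * cos z"
    using MVT2[of \<theta> \<phi> sin cos] assms by (auto intro: DERIV_sin)
  have "cos (pi / 3) \<le> cos z"
    using z assms pi_gt3 by (intro cos_monotone_0_pi_le) auto
  then have "(\<phi> - \<theta>) * (1/2) \<le> (\<phi> - \<theta>) * cos z"
    using assms by (intro mult_left_mono) (auto simp: cos_60)
  then show ?thesis using z by simp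
qed simp

text \<open>The rotation of \<open>(r, 0)\<close> by the angle \<open>- \<theta>\<close>.\<close>

definition arc_point :: "real \<Rightarrow> real \<Rightarrow> real^2" where
  "arc_point r \<theta> = vector [r * cos \<theta>, - (r * sin \<theta>)]"

lemma arc_point_eq_axis: "arc_point r \<theta> = (r * cos \<theta>) *\<^sub>R axis 1 1 - (r * sin \<theta>) *\<^sub>R axis 2 1"
  by (simp add: arc_point_def vec_eq_iff forall_2 axis_def)

lemma continuous_on_arc_point: "continuous_on S (arc_point r)"
  unfolding arc_point_eq_axis[abs_def] by (intro continuous_intros)

lemma dist_arc_point_le:
  assumes "0 \<le> r"
  shows "dist (arc_point r \<theta>) (arc_point r \<phi>) \<le> 2 * r * \<bar>\<theta> - \<phi>\<bar>"
proof -
  \<comment> \<open>Sum-to-product formulas, with one factor bounded by half the angle difference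
    and the other by 1.\<close>
  have s: "\<bar>sin \<theta> - sin \<phi>\<bar> \<le> \<bar>\<theta> - \<phi>\<bar>"
    using mult_mono[OF abs_sin_x_le_abs_x[of "(\<theta> - \<phi>) / 2"] abs_cos_le_one[of "(\<theta> + \<phi>) / 2"]]
    by (simp add: sin_diff_sin abs_mult)
  have c: "\<bar>cos \<theta> - cos \<phi>\<bar> \<le> \<bar>\<theta> - \<phi>\<bar>"
    using mult_mono[OF abs_sin_x_le_abs_x[of "(\<phi> - \<theta>) / 2"] abs_sin_le_one[of "(\<theta> + \<phi>) / 2"]]
    by (simp add: cos_diff_cos abs_mult abs_minus_commute mult.commute)
  have "dist (arc_point r \<theta>) (arc_point r \<phi>) \<le> r * \<bar>cos \<theta> - cos \<phi>\<bar> + r * \<bar>sin \<theta> - sin \<phi>\<bar>"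
    using norm_le_l1_cart[of "arc_point r \<theta> - arc_point r \<phi>"] assms
    by (simp add: dist_norm sum_2 arc_point_def abs_mult abs_minus_commute flip: right_diff_distrib)
  also have "\<dots> \<le> r * \<bar>\<theta> - \<phi>\<bar> + r * \<bar>\<theta> - \<phi>\<bar>"
    using s c assms by (intro add_mono mult_left_mono)
  finally show ?thesis by simp
qed

lemma dist_arc_point_ge:
  assumes "0 \<le> r" "0 \<le> \<theta>" "\<theta> \<le> \<phi>" "\<phi> \<le> 1"
  shows "r * (\<phi> - \<theta>) / 2 \<le> dist (arc_point r \<theta>) (arc_point r \<phi>)"
proof -
  have "r * ((\<phi> - \<theta>) / 2) \<le> r * (sin \<phi> - sin \<theta>)"
    using assms sin_diff_ge_half by (intro mult_left_mono) auto
  also have "\<dots> = (arc_point r \<theta> - arc_point r \<phi>) $ 2" by (simp add: arc_point_def algebra_simps)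
  also have "\<dots> \<le> dist (arc_point r \<theta>) (arc_point r \<phi>)"
    unfolding dist_norm using component_le_norm_cart[of "arc_point r \<theta> - arc_point r \<phi>" 2] by linarith
  finally show ?thesis by simp
qed

text \<open>The bound on \<open>r * h\<close> puts the ends of the arc at distance at least
  s(\<Lambda>), so some point of it avoids all balls of radius s(\<Lambda>)/2. The bound on
  \<open>r * h'\<close> keeps the loss within the slack s(\<Lambda>)/2 - \<epsilon> when the angle
  moves by at most \<open>h'\<close>.\<close>

lemma arc_escapes:
  assumes \<Lambda>: "plane_lattice \<Lambda>" and \<epsilon>: "\<epsilon> < shortest_length \<Lambda> / 2" and "0 < r"
    and a: "0 \<le> a" "a + h \<le> 1" and h: "2 * shortest_length \<Lambda> \<le> r * h"
    and h': "0 < h'" "h' \<le> h" "2 * r * h' \<le> shortest_length \<Lambda> / 2 - \<epsilon>"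
  shows "\<exists>b\<ge>a. b + h' \<le> a + h \<and> {b..b + h'} \<subseteq> {\<theta>. \<forall>l\<in>\<Lambda>. \<epsilon> \<le> dist l (arc_point r \<theta>)}"
proof -
  have "\<exists>\<theta>\<in>{a..a + h}. \<forall>l\<in>\<Lambda>. shortest_length \<Lambda> / 2 \<le> dist l (arc_point r \<theta>)"
  proof (rule ccontr)
    assume "\<not> ?thesis"
    then have "arc_point r ` {a..a + h} \<subseteq> (\<Union>l\<in>\<Lambda>. ball l (shortest_length \<Lambda> / 2))"
      by (auto simp: not_le)
    moreover have "connected (arc_point r ` {a..a + h})"
      by (intro connected_continuous_image continuous_on_arc_point) simp
    ultimately have "dist (arc_point r a) (arc_point r (a + h)) < shortest_length \<Lambda>"
      using h' by (intro connected_lattice_balls[OF \<Lambda>]) auto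
    then show False using dist_arc_point_ge[of r a "a + h"] assms by auto
  qed
  then obtain \<theta> where \<theta>: "a \<le> \<theta>" "\<theta> \<le> a + h"
    "\<And>l. l \<in> \<Lambda> \<Longrightarrow> shortest_length \<Lambda> / 2 \<le> dist l (arc_point r \<theta>)" by auto
  \<comment> \<open>The interval starts at \<open>\<theta>\<close> unless it would overrun
    \<open>a + h\<close>; then it is pushed back to end there and still contains
    \<open>\<theta>\<close>.\<close>
  define b where "b = min \<theta> (a + h - h')"
  have "\<epsilon> \<le> dist l (arc_point r \<phi>)" if "\<phi> \<in> {b..b + h'}" "l \<in> \<Lambda>" for \<phi> l
  proof -
    have "\<bar>\<phi> - \<theta>\<bar> \<le> h'" using that(1) \<theta> h' by (auto simp: b_def)
    then have "2 * r * \<bar>\<phi> - \<theta>\<bar> \<le> 2 * r * h'" using \<open>0 < r\<close> by simp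
    then have "dist (arc_point r \<phi>) (arc_point r \<theta>) \<le> shortest_length \<Lambda> / 2 - \<epsilon>"
      using dist_arc_point_le[of r \<phi> \<theta>] \<open>0 < r\<close> h' by linarith
    then show ?thesis using \<theta>(3)[OF that(2)] dist_triangle[of l "arc_point r \<theta>" "arc_point r \<phi>"] by linarith
  qed
  then show ?thesis using \<theta> h' by (intro exI[of _ b]) (auto simp: b_def)
qed

text \<open>Translates covering of an axis point by a rotated set into a condition on
  \<open>arc_point\<close>.\<close>

lemma rotation_eq_axis_imp:
  assumes "rotation \<theta> y = vector [r, 0]"
  shows "y = arc_point r \<theta>"
proof -
  have 1: "cos \<theta> * y$1 - sin \<theta> * y$2 = r" and 2: "sin \<theta> * y$1 + cos \<theta> * y$2 = 0"
    using assms by (auto simp: rotation_def vec_eq_iff forall_2)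
  \<comment> \<open>Apply the inverse rotation matrix to the two equations.\<close>
  have "r * cos \<theta> = y$1 * ((sin \<theta>)\<^sup>2 + (cos \<theta>)\<^sup>2) - sin \<theta> * (sin \<theta> * y$1 + cos \<theta> * y$2)"
    unfolding 1[symmetric] by (simp only: power2_eq_square algebra_simps)
  moreover have "- (r * sin \<theta>) =
      y$2 * ((sin \<theta>)\<^sup>2 + (cos \<theta>)\<^sup>2) - cos \<theta> * (sin \<theta> * y$1 + cos \<theta> * y$2)"
    unfolding 1[symmetric] by (simp only: power2_eq_square algebra_simps)
  ultimately show ?thesis unfolding 2 by (simp add: arc_point_def vec_eq_iff forall_2)
qed

theorem corollary4:
  fixes \<Lambda> :: "(real^2) set" and \<epsilon> :: real
  assumes "plane_lattice \<Lambda>" and "0 < \<epsilon>" and "\<epsilon> < shortest_length \<Lambda> / 2"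
  shows "\<exists>\<Theta> \<subseteq> sphere 0 1. infinite \<Theta> \<and> closed \<Theta> \<and> \<not> good \<Lambda> \<epsilon> \<Theta>"
proof -
  define s where "s = shortest_length \<Lambda>"
  \<comment> \<open>\<open>r n\<close> and \<open>q\<close> turn the two size conditions of \<open>arc_escapes\<close>, for \<open>h = q ^ n / 3\<close> and
    \<open>h' = q ^ Suc n\<close>, into equalities.\<close>
  define q where "q = (s / 2 - \<epsilon>) / (12 * s)"
  define r where "r n = 6 * s / q ^ n" for n
  define D where "D n = {\<theta>. \<forall>l\<in>\<Lambda>. \<epsilon> \<le> dist l (arc_point (r n) \<theta>)}" for n
  define A where "A = {\<theta>\<in>{0..1}. \<forall>n. \<theta> \<in> D n}"
  define p :: "real \<Rightarrow> real^2" where "p \<theta> = vector [cos \<theta>, sin \<theta>]" for \<theta>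
  have s: "0 < s" "\<epsilon> < s / 2" using assms by (auto simp: s_def)
  \<comment> \<open>The bound 1/3 gives \<open>q ^ Suc n \<le> q ^ n / 3\<close>, that is,
    \<open>h' \<le> h\<close>.\<close>
  have q: "0 < q" "q \<le> 1 / 3" using s assms(2) by (auto simp: q_def field_simps)
  have "infinite {\<theta>\<in>{0..0 + q ^ 0}. \<forall>n\<ge>0. \<theta> \<in> D n}"
  proof (rule branching_intervals_infinite)
    fix n :: nat and a :: real
    assume a: "0 \<le> a" "a + q ^ n / 3 \<le> 1"
    show "\<exists>b\<ge>a. b + q ^ Suc n \<le> a + q ^ n / 3 \<and> {b..b + q ^ Suc n} \<subseteq> D n"
      unfolding D_def
    proof (rule arc_escapes[OF assms(1,3) _ a])
      show "2 * r n * q ^ Suc n \<le> shortest_length \<Lambda> / 2 - \<epsilon>"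
        using s q by (simp add: r_def flip: s_def) (simp add: q_def)
    qed (use s q in \<open>auto simp: r_def simp flip: s_def\<close>)
  qed (use q in auto)
  then have "infinite A" by (simp add: A_def)
  moreover have "inj_on p A"
  proof (rule linorder_inj_onI)
    fix x y assume "x < y" "x \<in> A" "y \<in> A"
    then have "sin x < sin y" using sin_diff_ge_half[of x y] by (auto simp: A_def)
    then show "p x \<noteq> p y" by (auto simp: p_def vec_eq_iff forall_2)
  qed auto
  ultimately have inf: "infinite (p ` A)" by (simp add: finite_image_iff)
  have "closed (D n)" for n
    unfolding D_def Collect_ball_eq by (intro closed_INT ballI closed_Collect_le continuous_intros continuous_on_arc_point)
  then have "closed (\<Inter>n. D n)" by blast
  moreover have "A = {0..1} \<inter> (\<Inter>n. D n)" by (auto simp: A_def)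
  ultimately have "compact A" by (simp add: compact_Int_closed)
  moreover have "p = (\<lambda>\<theta>. cos \<theta> *\<^sub>R axis 1 1 + sin \<theta> *\<^sub>R axis 2 1)"
    by (auto simp: p_def vec_eq_iff forall_2 axis_def)
  then have "continuous_on A p" by (auto intro!: continuous_intros)
  ultimately have closed: "closed (p ` A)"
    by (intro compact_imp_closed compact_continuous_image)
  have sphere: "p ` A \<subseteq> sphere 0 1"
    by (auto simp: p_def norm_vec_def L2_set_def sum_2)
  have "\<not> good \<Lambda> \<epsilon> (p ` A)"
  proof
    assume "good \<Lambda> \<epsilon> (p ` A)"
    then obtain c R where cR: "- ball c R \<subseteq> rotate_set (p ` A) (thickening \<Lambda> \<epsilon>)"
      by (auto simp: good_def)
    \<comment> \<open>Chosen so that \<open>r n\<close> exceeds \<open>norm c + R\<close>, which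
      puts the axis point \<open>x\<close> outside the disk.\<close>
    obtain n where n: "(norm c + R) / (6 * s) < (1 / q) ^ n"
      using real_arch_pow[of "1 / q"] q by auto
    define x :: "real^2" where "x = vector [r n, 0]"
    have "norm c + R < r n" using n s by (simp add: r_def field_simps)
    also have "r n = norm x"
      using s q by (simp add: x_def norm_vec_def L2_set_def sum_2 r_def)
    finally have "x \<notin> ball c R" using norm_triangle_ineq2[of x c] by (simp add: dist_norm norm_minus_commute)
    then have "x \<in> rotate_set (p ` A) (thickening \<Lambda> \<epsilon>)" using cR by blast
    then obtain \<phi> y where y: "x = rotation \<phi> y" "p \<phi> \<in> p ` A" "y \<in> thickening \<Lambda> \<epsilon>"
      by (auto simp: rotate_set_def p_def)
    \<comment> \<open>\<open>\<phi>\<close> is determined only mod 2 pi and may lie outside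
      \<open>A\<close>; a representative in \<open>A\<close> gives the same
      \<open>arc_point\<close>.\<close>
    then obtain \<theta> where "\<theta> \<in> A" "p \<phi> = p \<theta>" by blast
    then have "arc_point (r n) \<phi> = arc_point (r n) \<theta>" by (simp add: arc_point_def p_def vec_eq_iff forall_2)
    then have "y = arc_point (r n) \<theta>" using rotation_eq_axis_imp y(1) by (metis x_def)
    moreover obtain l where "l \<in> \<Lambda>" "dist l y < \<epsilon>"
      using y(3) by (auto simp: thickening_def dist_norm)
    ultimately show False using \<open>\<theta> \<in> A\<close> by (auto simp: A_def D_def simp flip: not_less)
  qed
  with inf closed sphere show ?thesis by blast
qed

end
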